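(* Let $\mathfrak{g}$ be a non Abelian finite dimensional complex quadratic Lie algebra. Then $\dim([\mathfrak{g},\mathfrak{g}])\ge3$. Moreover, $\mathfrak{g}$ is elementary if and only if $\dim([\mathfrak{g},\mathfrak{g}])=3$.
   Context: A quadratic Lie algebra is a Lie algebra with a non degenerate symmetric invariant bilinear form $B$. $I_{\mathfrak{g}}\in\bigwedge^3\mathfrak{g}$ (the space of skew symmetric trilinear forms on $\mathfrak{g}$) is defined by $I_{\mathfrak{g}}(X,Y,Z)=B([X,Y],Z)$. $\mathfrak{g}$ is called elementary if $I_{\mathfrak{g}}$ is decomposable, i.e. $I_{\mathfrak{g}}=\omega_1\wedge\omega_2\wedge\omega_3$ with $\omega_1,\omega_2,\omega_3\in\mathfrak{g}^*$. *)

theory Defs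
  imports "HOL-Analysis.Determinants"
begin

locale lie_algebra = vector_space scale
  for scale :: "'k::field \<Rightarrow> 'a::ab_group_add \<Rightarrow> 'a" +
  fixes bracket :: "'a \<Rightarrow> 'a \<Rightarrow> 'a"
  assumes bracket_linear_left: "Vector_Spaces.linear scale scale (\<lambda>x. bracket x y)"
    and bracket_linear_right: "Vector_Spaces.linear scale scale (\<lambda>y. bracket x y)"
    and bracket_self: "bracket x x = 0"
    and jacobi: "bracket x (bracket y z) + bracket y (bracket z x) + bracket z (bracket x y) = 0"
begin

definition abelian :: bool where
  "abelian \<longleftrightarrow> (\<forall>x y. bracket x y = 0)"

definition derived_algebra :: "'a set" where
  "derived_algebra = span {bracket x y | x y. True}"

end

locale quadratic_lie_algebra = lie_algebra scale bracket
  for scale :: "'k::field \<Rightarrow> 'a::ab_group_add \<Rightarrow> 'a"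
    and bracket :: "'a \<Rightarrow> 'a \<Rightarrow> 'a" +
  fixes B :: "'a \<Rightarrow> 'a \<Rightarrow> 'k"
  assumes form_linear_left: "Vector_Spaces.linear scale (*) (\<lambda>x. B x y)"
    and form_linear_right: "Vector_Spaces.linear scale (*) (\<lambda>y. B x y)"
    and form_symmetric: "B x y = B y x"
    and form_nondegenerate: "(\<And>y. B x y = 0) \<Longrightarrow> x = 0"
    and form_invariant: "B (bracket x y) z = B x (bracket y z)"

text \<open>The wedge product of three linear forms, viewed as a skew symmetric trilinear form,
  normalised without a factor 1/6. Over the complex numbers the normalisation does not affect
  which forms are decomposable.\<close>

definition wedge3 :: "('a \<Rightarrow> 'k) \<Rightarrow> ('a \<Rightarrow> 'k) \<Rightarrow> ('a \<Rightarrow> 'k) \<Rightarrow> 'a \<Rightarrow> 'a \<Rightarrow> 'a \<Rightarrow> 'k::field" where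
  "wedge3 \<omega>\<^sub>1 \<omega>\<^sub>2 \<omega>\<^sub>3 x y z =
     det (vector [vector [\<omega>\<^sub>1 x, \<omega>\<^sub>1 y, \<omega>\<^sub>1 z],
                  vector [\<omega>\<^sub>2 x, \<omega>\<^sub>2 y, \<omega>\<^sub>2 z],
                  vector [\<omega>\<^sub>3 x, \<omega>\<^sub>3 y, \<omega>\<^sub>3 z]] :: 'k ^ 3 ^ 3)"

context quadratic_lie_algebra
begin

definition I_form :: "'a \<Rightarrow> 'a \<Rightarrow> 'a \<Rightarrow> 'k" where
  "I_form x y z = B (bracket x y) z"

definition elementary :: bool where
  "elementary \<longleftrightarrow>
     (\<exists>\<omega>\<^sub>1 \<omega>\<^sub>2 \<omega>\<^sub>3. Vector_Spaces.linear scale (*) \<omega>\<^sub>1 \<and>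
        Vector_Spaces.linear scale (*) \<omega>\<^sub>2 \<and> Vector_Spaces.linear scale (*) \<omega>\<^sub>3 \<and>
        I_form = wedge3 \<omega>\<^sub>1 \<omega>\<^sub>2 \<omega>\<^sub>3)"

end

end

theory Submission
  imports Defs
begin

text \<open>The trilinear form \<open>I(x,y,z) = B([x,y],z)\<close> is alternating. In the non abelian case choose
  \<open>a, b, c\<close> with \<open>I(a,b,c) = 1\<close>; then \<open>[b,c], [c,a], [a,b]\<close> is dual to \<open>a, b, c\<close> under \<open>B\<close>, so these
  brackets are independent and the derived algebra has dimension at least 3. It has dimension
  exactly 3 if and only if the three brackets span it, that is, if and only if every \<open>[x,y]\<close> equals
  \<open>I(x,y,a) [b,c] + I(x,y,b) [c,a] + I(x,y,c) [a,b]\<close>. For a decomposable \<open>I\<close> this is a Pluecker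
  relation; conversely, applying the formula twice writes \<open>I\<close> as the wedge product of the three forms
  \<open>B([b,c],-)\<close>, \<open>B([c,a],-)\<close>, \<open>B([a,b],-)\<close>.\<close>

lemma wedge3_expand:
  "wedge3 f g h x y z = f x * g y * h z + f y * g z * h x + f z * g x * h y
     - f x * g z * h y - f y * g x * h z - f z * g y * h x"
  by (simp add: wedge3_def det_3 vector_3)

text \<open>Map vectors to triples by \<open>(f, g, h)\<close>. Cramer's rule expresses det(a,b,c) z
  through the images of \<open>a\<close>, \<open>b\<close>, \<open>c\<close>, with coefficients
  det(b,c,z), det(c,a,z), det(a,b,z); now apply det(x,y,-).\<close>

lemma wedge3_pluecker:
  "wedge3 f g h a b c * wedge3 f g h x y z =
     wedge3 f g h x y a * wedge3 f g h b c z + wedge3 f g h x y b * wedge3 f g h c a z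
     + wedge3 f g h x y c * wedge3 f g h a b z"
  unfolding wedge3_expand by algebra

context quadratic_lie_algebra
begin

sublocale left: Vector_Spaces.linear scale "(*)" "\<lambda>x. B x y" for y
  by (rule form_linear_left)

sublocale right: Vector_Spaces.linear scale "(*)" "\<lambda>y. B x y" for x
  by (rule form_linear_right)

sublocale bracket_left: Vector_Spaces.linear scale scale "\<lambda>x. bracket x y" for y
  by (rule bracket_linear_left)

sublocale bracket_right: Vector_Spaces.linear scale scale "\<lambda>y. bracket x y" for x
  by (rule bracket_linear_right)

lemma I_form_cyclic: "I_form x y z = I_form y z x"
  unfolding I_form_def by (metis form_invariant form_symmetric)

lemma I_form_repeat [simp]: "I_form x x z = 0" "I_form x y y = 0" "I_form x y x = 0"
proof -
  show first: "I_form x x z = 0" for x z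
    by (simp add: I_form_def bracket_self left.zero)
  show "I_form x y y = 0" "I_form x y x = 0"
    using first I_form_cyclic by metis+
qed

lemma form_eqI: "x = y" if "\<And>z. B x z = B y z"
proof -
  have "x - y = 0"
    by (rule form_nondegenerate) (simp add: left.diff that)
  then show ?thesis by simp
qed

lemma obtain_normalized_triple:
  assumes "\<not> abelian"
  obtains a b c where "I_form a b c = 1"
proof -
  obtain a b where "bracket a b \<noteq> 0"
    using assms unfolding abelian_def by blast
  then obtain c where c: "B (bracket a b) c \<noteq> 0"
    using form_nondegenerate by blast
  have "I_form a b (scale (1 / B (bracket a b) c) c) = 1"
    using c by (simp add: I_form_def right.scale)
  then show ?thesis by (rule that)
qed

lemma bracket_in_derived_algebra: "bracket x y \<in> derived_algebra"
  unfolding derived_algebra_def by (rule span_base) blast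

definition bracket_combination :: "'a \<Rightarrow> 'a \<Rightarrow> 'a \<Rightarrow> 'k \<Rightarrow> 'k \<Rightarrow> 'k \<Rightarrow> 'a" where
  "bracket_combination a b c p q r =
     scale p (bracket b c) + scale q (bracket c a) + scale r (bracket a b)"

lemma form_bracket_combination:
  "B (bracket_combination a b c p q r) z = p * I_form b c z + q * I_form c a z + r * I_form a b z"
  by (simp add: bracket_combination_def I_form_def left.add left.scale)

text \<open>By cyclicity the three matching pairings all equal \<open>I_form a b c\<close>, and the
  mixed ones vanish because an argument repeats. Hence a combination determines its
  coefficients.\<close>

lemma form_bracket_combination_triple:
  assumes "I_form a b c = 1"
  shows "B (bracket_combination a b c p q r) a = p"
    and "B (bracket_combination a b c p q r) b = q"
    and "B (bracket_combination a b c p q r) c = r"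
  using assms I_form_cyclic[of a b c] I_form_cyclic[of c a b]
  by (simp_all add: form_bracket_combination)

lemma span_triple_brackets:
  "x \<in> span {bracket b c, bracket c a, bracket a b} \<longleftrightarrow>
     (\<exists>p q r. x = bracket_combination a b c p q r)"
proof
  assume "x \<in> span {bracket b c, bracket c a, bracket a b}"
  \<comment> \<open>\<open>span_insert\<close> peels off one generator at a time until the span of
    the empty set remains.\<close>
  then obtain p q r where
    "x - scale p (bracket b c) - scale q (bracket c a) - scale r (bracket a b) = 0"
    by (auto simp: span_insert)
  then have "x = bracket_combination a b c p q r"
    by (simp add: bracket_combination_def algebra_simps)
  then show "\<exists>p q r. x = bracket_combination a b c p q r" by blast
next
  assume "\<exists>p q r. x = bracket_combination a b c p q r"
  then show "x \<in> span {bracket b c, bracket c a, bracket a b}"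
    unfolding bracket_combination_def
    by (auto intro!: span_add span_scale intro: span_base)
qed

lemma triple_brackets_independent:
  assumes "I_form a b c = 1"
  shows "independent {bracket b c, bracket c a, bracket a b}"
    and "card {bracket b c, bracket c a, bracket a b} = 3"
proof -
  have *: "p = p' \<and> q = q' \<and> r = r'"
    if "bracket_combination a b c p q r = bracket_combination a b c p' q' r'" for p q r p' q' r'
    using form_bracket_combination_triple[OF assms] that by metis
  \<comment> \<open>Both the cardinality and the sum over the set need that no two of the brackets
    coincide; equal ones would give two different coefficient triples for one vector.\<close>
  have distinct: "bracket b c \<noteq> bracket c a" "bracket b c \<noteq> bracket a b" "bracket c a \<noteq> bracket a b"
    using *[of 1 0 0 0 1 0] *[of 1 0 0 0 0 1] *[of 0 1 0 0 0 1]
    by (auto simp: bracket_combination_def)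
  then show "card {bracket b c, bracket c a, bracket a b} = 3" by simp
  show "independent {bracket b c, bracket c a, bracket a b}"
  proof (rule independent_if_scalars_zero)
    fix f x
    assume sum: "(\<Sum>x\<in>{bracket b c, bracket c a, bracket a b}. scale (f x) x) = 0"
      and x: "x \<in> {bracket b c, bracket c a, bracket a b}"
    have "bracket_combination a b c (f (bracket b c)) (f (bracket c a)) (f (bracket a b)) =
        bracket_combination a b c 0 0 0"
      using sum distinct by (simp add: bracket_combination_def add.assoc)
    from *[OF this] x show "f x = 0" by blast
  qed simp
qed

lemma elementary_imp_derived_subset:
  assumes elementary and one: "I_form a b c = 1"
  shows "derived_algebra \<subseteq> span {bracket b c, bracket c a, bracket a b}"
proof -
  obtain f g h where I: "I_form = wedge3 f g h"
    using assms(1) unfolding elementary_def by blast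
  have "bracket x y = bracket_combination a b c (I_form x y a) (I_form x y b) (I_form x y c)" for x y
  proof (rule form_eqI)
    fix z
    \<comment> \<open>The factor \<open>I_form a b c\<close>, equal to 1, is inserted to give the
      left side of the Pluecker relation.\<close>
    have "B (bracket x y) z = I_form a b c * I_form x y z"
      by (simp add: one I_form_def[of x y z])
    also have "\<dots> = I_form x y a * I_form b c z + I_form x y b * I_form c a z + I_form x y c * I_form a b z"
      unfolding I by (rule wedge3_pluecker)
    finally show "B (bracket x y) z =
        B (bracket_combination a b c (I_form x y a) (I_form x y b) (I_form x y c)) z"
      by (simp add: form_bracket_combination)
  qed
  then have "{bracket x y | x y. True} \<subseteq> span {bracket b c, bracket c a, bracket a b}"
    using span_triple_brackets by blast
  then show ?thesis
    unfolding derived_algebra_def by (simp add: span_minimal subspace_span)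
qed

lemma derived_subset_imp_elementary:
  assumes one: "I_form a b c = 1"
    and sub: "derived_algebra \<subseteq> span {bracket b c, bracket c a, bracket a b}"
  shows elementary
proof -
  have expand: "I_form x y z = I_form x y a * I_form b c z + I_form x y b * I_form c a z
      + I_form x y c * I_form a b z" for x y z
  proof -
    obtain p q r where pqr: "bracket x y = bracket_combination a b c p q r"
      using sub bracket_in_derived_algebra span_triple_brackets by blast
    have "I_form x y a = p" "I_form x y b = q" "I_form x y c = r"
      by (simp_all add: I_form_def pqr form_bracket_combination_triple[OF one])
    then show ?thesis
      by (simp add: I_form_def[of x y z] pqr form_bracket_combination)
  qed
  have swap: "I_form x y z = - I_form y x z" for x y z
  proof -
    have "bracket (x + y) (x + y) = bracket x x + bracket x y + (bracket y x + bracket y y)"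
      by (simp add: bracket_left.add bracket_right.add ac_simps)
    then have "bracket x y = - bracket y x"
      by (simp add: bracket_self eq_neg_iff_add_eq_0)
    then show ?thesis by (simp add: I_form_def left.neg)
  qed
  have "I_form x y z = wedge3 (I_form b c) (I_form c a) (I_form a b) x y z" for x y z
  proof -
    \<comment> \<open>Applied to the rotated \<open>I_form d x y\<close>, \<open>expand\<close>
      turns the coefficients \<open>I_form x y d\<close>, for \<open>d\<close> among
      \<open>a\<close>, \<open>b\<close>, \<open>c\<close>, into 2 by 2 minors after
      \<open>swap\<close>. Then \<open>expand[of x y z]\<close> is the Laplace expansion of the
      determinant along its last column.\<close>
    have third: "I_form x y d = I_form a d x * I_form b c y + I_form b d x * I_form c a y
      + I_form c d x * I_form a b y" for d
      using expand[of d x y] I_form_cyclic[of d x y] I_form_cyclic[of _ d x] by simp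
    show ?thesis
      unfolding wedge3_expand expand[of x y z] third[of a] third[of b] third[of c]
      using swap[of b a x] swap[of c b x] swap[of a c x]
      by (simp add: algebra_simps)
  qed
  moreover have "Vector_Spaces.linear scale (*) (I_form x y)" for x y
    unfolding I_form_def by (rule form_linear_right)
  ultimately show ?thesis
    unfolding elementary_def by blast
qed

end

theorem proposition6p1p4:
  fixes scale :: "complex \<Rightarrow> 'a::ab_group_add \<Rightarrow> 'a"
    and bracket :: "'a \<Rightarrow> 'a \<Rightarrow> 'a"
    and B :: "'a \<Rightarrow> 'a \<Rightarrow> complex"
  assumes "quadratic_lie_algebra scale bracket B"
    and "\<exists>Basis. finite_dimensional_vector_space scale Basis"
    and "\<not> lie_algebra.abelian bracket"
  shows "vector_space.dim scale (lie_algebra.derived_algebra scale bracket) \<ge> 3 \<and>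
    (quadratic_lie_algebra.elementary scale bracket B \<longleftrightarrow>
       vector_space.dim scale (lie_algebra.derived_algebra scale bracket) = 3)"
proof -
  interpret quadratic_lie_algebra scale bracket B by (rule assms)
  obtain Basis where "finite_dimensional_vector_space scale Basis"
    using assms(2) by blast
  then interpret fin: finite_dimensional_vector_space scale Basis .
  obtain a b c where one: "I_form a b c = 1"
    using obtain_normalized_triple assms(3) by blast
  define U where "U = {bracket b c, bracket c a, bracket a b}"
  have U: "independent U" "card U = 3" "U \<subseteq> derived_algebra"
    using triple_brackets_independent[OF one] bracket_in_derived_algebra by (auto simp: U_def)
  \<comment> \<open>Finite dimension matters here: the \<open>dim\<close> of a subspace with an
    infinite basis would be 0.\<close>
  have ge: "3 \<le> dim derived_algebra"
    using fin.independent_card_le_dim[OF U(3) U(1)] U(2) by simp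
  \<comment> \<open>An independent subset with as many elements as the dimension spans; conversely,
    a spanning set of 3 elements bounds the dimension from above.\<close>
  have "dim derived_algebra = 3 \<longleftrightarrow> derived_algebra \<subseteq> span U"
  proof
    assume "dim derived_algebra = 3"
    then show "derived_algebra \<subseteq> span U"
      using fin.card_ge_dim_independent[OF U(3) U(1)] U(2) by simp
  next
    assume "derived_algebra \<subseteq> span U"
    then have "dim derived_algebra \<le> 3"
      using dim_le_card[of derived_algebra U] U(2) by (simp add: U_def)
    with ge show "dim derived_algebra = 3" by simp
  qed
  then show ?thesis
    using ge elementary_imp_derived_subset[OF _ one] derived_subset_imp_elementary[OF one]
    unfolding U_def by blast
qed

end
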